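(* Let $\sigma(s)$ be a closed almost regular canal in $\Lambda^4$, i.e. a closed space-like curve in $\Lambda^4$, parametrized by arc-length $s$, whose geodesic curvature vector $\vec{k}_g(s)=\sigma(s)+\ddot\sigma(s)$ satisfies $\langle \vec k_g(s),\vec k_g(s)\rangle\le 0$ and $\vec k_g(s)\neq 0$ for every $s$. Then the length $\ell$ of $\sigma$ satisfies $\ell\ge 2\pi$. Moreover, $\ell=2\pi$ if and only if the line $\mathrm{span}(\vec k_g(s))$ is light-like and constant (independent of $s$).
   Context: Let $\langle x,y\rangle=x_1y_1+x_2y_2+x_3y_3+x_4y_4-x_5y_5$ be the Lorentz form on $\mathbb{R}^5$. De Sitter space is $\Lambda^4=\{x\in\mathbb{R}^5 : \langle x,x\rangle=1\}$, with the Lorentz metric induced by $\langle\ ,\ \rangle$. A vector $v$ is space-like, time-like or light-like if $\langle v,v\rangle$ is $>0$, $<0$ or $=0$ respectively. A curve $\sigma(t)$ in $\Lambda^4$ (curves are smooth) is space-like if $\langle\sigma'(t),\sigma'(t)\rangle>0$ for all $t$; such a curve is also called a canal, since it corresponds to a one-parameter family of oriented 2-spheres of $\mathbb{S}^3$ having an envelope. Its length is $\int \langle\sigma'(t),\sigma'(t)\rangle^{1/2}\,dt$, and it can be parametrized by arc-length $s$, so that $\langle\dot\sigma,\dot\sigma\rangle=1$, dots denoting derivatives with respect to $s$. The geodesic curvature vector $\vec k_g(s)$ is the Lorentz-orthogonal projection of $\ddot\sigma(s)$ onto $T_{\sigma(s)}\Lambda^4=\sigma(s)^\bot$, and it equals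 $\sigma(s)+\ddot\sigma(s)$. "Closed" means that $\sigma$ is a curve $\mathbb{S}^1\to\Lambda^4$, i.e. in arc-length parameter it extends to a smooth $\ell$-periodic function on $\mathbb{R}$, where $\ell$ is its length.
   Formalization: The converse (constant light-like line implies length 2π) is stated only for simple closed curves; it fails otherwise, e.g. for (cos s, sin s, g, 0, g) with g = 2 + cos(s/2), of length 4π. The bound and the other direction hold for all closed almost regular canals. *)

theory Defs
  imports "HOL-Analysis.Analysis"
begin

text \<open>In the index type \<open>5\<close> the numeral \<open>5\<close> denotes the same element as \<open>0\<close>, so the indices
  \<open>1, 2, 3, 4, 5\<close> below are its five distinct elements.\<close>

definition lorentz :: "real^5 \<Rightarrow> real^5 \<Rightarrow> real" where
  "lorentz x y = x$1 * y$1 + x$2 * y$2 + x$3 * y$3 + x$4 * y$4 - x$5 * y$5"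

definition space_like :: "real^5 \<Rightarrow> bool" where
  "space_like v \<longleftrightarrow> lorentz v v > 0"

definition light_like :: "real^5 \<Rightarrow> bool" where
  "light_like v \<longleftrightarrow> lorentz v v = 0"

definition de_sitter :: "(real^5) set" where
  "de_sitter = {x. lorentz x x = 1}"

definition vderiv :: "(real \<Rightarrow> real^5) \<Rightarrow> real \<Rightarrow> real^5" where
  "vderiv \<sigma> = (\<lambda>t. vector_derivative \<sigma> (at t))"

definition smooth_curve :: "(real \<Rightarrow> real^5) \<Rightarrow> bool" where
  "smooth_curve \<sigma> \<longleftrightarrow> (\<forall>n t. (vderiv ^^ n) \<sigma> differentiable (at t))"

text \<open>A closed curve \<open>S\<^sup>1 \<rightarrow> \<Lambda>\<^sup>4\<close> is represented by a smooth \<open>T\<close>-periodic function on the line; \<open>T\<close> is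
  a period, one circuit of the circle, and need not be the smallest one. Self-intersections
  are allowed.\<close>

definition closed_space_like_curve :: "(real \<Rightarrow> real^5) \<Rightarrow> real \<Rightarrow> bool" where
  "closed_space_like_curve \<sigma> T \<longleftrightarrow>
     0 < T \<and> smooth_curve \<sigma> \<and> (\<forall>t. \<sigma> (t + T) = \<sigma> t) \<and>
     (\<forall>t. \<sigma> t \<in> de_sitter) \<and> (\<forall>t. space_like (vderiv \<sigma> t))"

definition simple_closed :: "(real \<Rightarrow> real^5) \<Rightarrow> real \<Rightarrow> bool" where
  "simple_closed \<sigma> T \<longleftrightarrow> inj_on \<sigma> {0..<T}"

definition closed_length :: "(real \<Rightarrow> real^5) \<Rightarrow> real \<Rightarrow> real" where
  "closed_length \<sigma> T = integral {0..T} (\<lambda>t. sqrt (lorentz (vderiv \<sigma> t) (vderiv \<sigma> t)))"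

definition arc_length_parametrized :: "(real \<Rightarrow> real^5) \<Rightarrow> bool" where
  "arc_length_parametrized \<sigma> \<longleftrightarrow> (\<forall>s. lorentz (vderiv \<sigma> s) (vderiv \<sigma> s) = 1)"

text \<open>Lorentz-orthogonal projection onto the tangent space \<open>x\<^sup>\<bottom>\<close> of \<open>\<Lambda>\<^sup>4\<close> at \<open>x\<close>, where \<open>\<langle>x, x\<rangle> = 1\<close>.\<close>

definition tangent_projection :: "real^5 \<Rightarrow> real^5 \<Rightarrow> real^5" where
  "tangent_projection x v = v - lorentz v x *\<^sub>R x"

definition geodesic_curvature_vector :: "(real \<Rightarrow> real^5) \<Rightarrow> real \<Rightarrow> real^5" where
  "geodesic_curvature_vector \<sigma> s = tangent_projection (\<sigma> s) (vderiv (vderiv \<sigma>) s)"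

definition closed_almost_regular_canal :: "(real \<Rightarrow> real^5) \<Rightarrow> real \<Rightarrow> bool" where
  "closed_almost_regular_canal \<sigma> T \<longleftrightarrow>
     closed_space_like_curve \<sigma> T \<and> arc_length_parametrized \<sigma> \<and>
     (\<forall>s. lorentz (geodesic_curvature_vector \<sigma> s) (geodesic_curvature_vector \<sigma> s) \<le> 0 \<and>
          geodesic_curvature_vector \<sigma> s \<noteq> 0)"

definition curvature_line_light_like_constant :: "(real \<Rightarrow> real^5) \<Rightarrow> bool" where
  "curvature_line_light_like_constant \<sigma> \<longleftrightarrow>
     (\<exists>W. (\<forall>s. span {geodesic_curvature_vector \<sigma> s} = W) \<and> (\<forall>v\<in>W. light_like v))"

lemma lorentz_has_derivative:
  assumes "(f has_vector_derivative f') (at t)" "(g has_vector_derivative g') (at t)"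
  shows "((\<lambda>t. lorentz (f t) (g t)) has_real_derivative lorentz f' (g t) + lorentz (f t) g') (at t)"
proof -
  have c: "((\<lambda>t. h t $ i) has_real_derivative h' $ i) (at t)"
    if "(h has_vector_derivative h') (at t)" for h :: "real \<Rightarrow> real^5" and h' i
    using bounded_linear.has_vector_derivative[OF bounded_linear_vec_nth that]
    by (simp add: has_real_derivative_iff_has_vector_derivative)
  show ?thesis
    unfolding lorentz_def
    by (rule derivative_eq_intros c assms refl | simp add: algebra_simps)+
qed

lemma smooth_curve_vderiv:
  assumes "smooth_curve \<sigma>"
  shows "(\<sigma> has_vector_derivative vderiv \<sigma> t) (at t)"
    and "(vderiv \<sigma> has_vector_derivative vderiv (vderiv \<sigma>) t) (at t)"
proof -
  have "(vderiv ^^ 0) \<sigma> differentiable (at t)" "(vderiv ^^ 1) \<sigma> differentiable (at t)"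
    using assms unfolding smooth_curve_def by blast+
  then show "(\<sigma> has_vector_derivative vderiv \<sigma> t) (at t)"
    "(vderiv \<sigma> has_vector_derivative vderiv (vderiv \<sigma>) t) (at t)"
    by (simp_all add: vector_derivative_works vderiv_def)
qed

lemma geodesic_curvature_vector_eq:
  assumes "smooth_curve \<sigma>" "\<And>s. \<sigma> s \<in> de_sitter" "arc_length_parametrized \<sigma>"
  shows "geodesic_curvature_vector \<sigma> s = \<sigma> s + vderiv (vderiv \<sigma>) s"
proof -
  have comm: "lorentz x y = lorentz y x" for x y by (simp add: lorentz_def)
  note d = smooth_curve_vderiv[OF assms(1)]
  have "lorentz (vderiv \<sigma> t) (\<sigma> t) = 0" for t
  proof -
    have "((\<lambda>t. lorentz (\<sigma> t) (\<sigma> t)) has_real_derivative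
        lorentz (vderiv \<sigma> t) (\<sigma> t) + lorentz (\<sigma> t) (vderiv \<sigma> t)) (at t)"
      by (rule lorentz_has_derivative) (rule d)+
    moreover have "(\<lambda>t. lorentz (\<sigma> t) (\<sigma> t)) = (\<lambda>t. 1)"
      using assms(2) by (auto simp: de_sitter_def)
    ultimately show ?thesis
      using DERIV_unique[OF _ DERIV_const[of 1]] comm[of "\<sigma> t"] by fastforce
  qed
  then have "((\<lambda>t. 0) has_real_derivative
      lorentz (vderiv (vderiv \<sigma>) s) (\<sigma> s) + lorentz (vderiv \<sigma> s) (vderiv \<sigma> s)) (at s)"
    using lorentz_has_derivative[OF d(2) d(1), of s] by simp
  then have "lorentz (vderiv (vderiv \<sigma>) s) (\<sigma> s) + lorentz (vderiv \<sigma> s) (vderiv \<sigma> s) = 0"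
    using DERIV_unique[OF _ DERIV_const[of 0]] by blast
  then have "lorentz (vderiv (vderiv \<sigma>) s) (\<sigma> s) = -1"
    using assms(3) by (simp add: arc_length_parametrized_def)
  then show ?thesis
    by (simp add: geodesic_curvature_vector_def tangent_projection_def)
qed

text \<open>A light-like constant line \<open>span {k\<^sub>g}\<close> forces length \<open>2 * pi\<close> only for simple closed curves.
  The closed canal below has such a line, length \<open>4 * pi\<close> and smallest period \<open>4 * pi\<close>: it goes
  around the circle in the first two coordinates twice and meets itself once.\<close>

definition double_canal :: "real \<Rightarrow> real^5" where
  "double_canal s = cos s *\<^sub>R axis 1 1 + sin s *\<^sub>R axis 2 1
     + (2 + cos (s / 2)) *\<^sub>R (axis 3 1 + axis 5 1)"

definition double_canal_deriv :: "nat \<Rightarrow> real \<Rightarrow> real^5" where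
  "double_canal_deriv n s = cos (s + n * pi / 2) *\<^sub>R axis 1 1 + sin (s + n * pi / 2) *\<^sub>R axis 2 1
     + ((if n = 0 then 2 else 0) + (1/2) ^ n * cos (s / 2 + n * pi / 2)) *\<^sub>R (axis 3 1 + axis 5 1)"

lemma vderiv_funpow_double_canal: "(vderiv ^^ n) double_canal = double_canal_deriv n"
  and double_canal_deriv_has_derivative:
    "(double_canal_deriv n has_vector_derivative double_canal_deriv (Suc n) s) (at s)"
proof -
  have d: "(double_canal_deriv n has_vector_derivative double_canal_deriv (Suc n) s) (at s)" for n s
  proof -
    have sh: "cos (x + real (Suc n) * pi / 2) = - sin (x + n * pi / 2)"
      "sin (x + real (Suc n) * pi / 2) = cos (x + n * pi / 2)" for x
    proof -
      have e: "x + real (Suc n) * pi / 2 = (x + n * pi / 2) + pi / 2" by (simp add: field_simps)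
      show "cos (x + real (Suc n) * pi / 2) = - sin (x + n * pi / 2)"
        "sin (x + real (Suc n) * pi / 2) = cos (x + n * pi / 2)"
        unfolding e by (simp_all add: cos_add sin_add)
    qed
    have 1: "((\<lambda>s. cos (s + n * pi / 2)) has_real_derivative - sin (s + n * pi / 2)) (at s)"
      "((\<lambda>s. sin (s + n * pi / 2)) has_real_derivative cos (s + n * pi / 2)) (at s)"
      "((\<lambda>s. (if n = 0 then 2 else 0) + (1/2) ^ n * cos (s / 2 + n * pi / 2))
        has_real_derivative - ((1/2) ^ Suc n * sin (s / 2 + n * pi / 2))) (at s)"
      by (auto intro!: derivative_eq_intros)
    have e: "double_canal_deriv (Suc n) s = - sin (s + n * pi / 2) *\<^sub>R axis 1 1
       + cos (s + n * pi / 2) *\<^sub>R axis 2 1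
       + (- ((1/2) ^ Suc n * sin (s / 2 + n * pi / 2))) *\<^sub>R (axis 3 1 + axis 5 1)"
      by (simp only: double_canal_deriv_def sh) simp
    have "(double_canal_deriv n has_vector_derivative (- sin (s + n * pi / 2) *\<^sub>R axis 1 1
       + cos (s + n * pi / 2) *\<^sub>R axis 2 1
       + (- ((1/2) ^ Suc n * sin (s / 2 + n * pi / 2))) *\<^sub>R (axis 3 1 + axis 5 1))) (at s)"
      unfolding double_canal_deriv_def[abs_def]
      by (rule derivative_eq_intros 1 refl | simp)+
    then show ?thesis by (simp only: e)
  qed
  show "(vderiv ^^ n) double_canal = double_canal_deriv n"
  proof (induction n)
    case 0 show ?case by (auto simp: double_canal_def double_canal_deriv_def)
  next
    case (Suc n) then show ?case by (auto simp: vderiv_def vector_derivative_at[OF d])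
  qed
  show "(double_canal_deriv n has_vector_derivative double_canal_deriv (Suc n) s) (at s)"
    by (rule d)
qed

lemma double_canal_counterexample:
  "closed_almost_regular_canal double_canal (4 * pi)"
  "curvature_line_light_like_constant double_canal"
  "closed_length double_canal (4 * pi) = 4 * pi"
  "\<And>T. 0 < T \<Longrightarrow> double_canal T = double_canal 0 \<Longrightarrow> 4 * pi \<le> T"
proof -
  let ?k = "geodesic_curvature_vector double_canal"
  let ?v = "axis 3 1 + axis 5 1 :: real^5"
  have d1: "vderiv double_canal = double_canal_deriv 1"
    using vderiv_funpow_double_canal[of 1] by simp
  have d2: "vderiv (vderiv double_canal) = double_canal_deriv 2"
    using vderiv_funpow_double_canal[of 2] by (simp add: numeral_2_eq_2)
  have lc: "lorentz (a *\<^sub>R axis 1 1 + b *\<^sub>R axis 2 1 + c *\<^sub>R ?v)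
      (a *\<^sub>R axis 1 1 + b *\<^sub>R axis 2 1 + c *\<^sub>R ?v) = a\<^sup>2 + b\<^sup>2" for a b c
    by (simp add: lorentz_def axis_def power2_eq_square)
  have sm: "smooth_curve double_canal"
    unfolding smooth_curve_def vderiv_funpow_double_canal
    using double_canal_deriv_has_derivative differentiableI_vector by blast
  have ds: "double_canal s \<in> de_sitter" for s
    by (simp only: de_sitter_def mem_Collect_eq double_canal_def lc) simp
  have al: "lorentz (vderiv double_canal s) (vderiv double_canal s) = 1" for s
    by (simp only: d1 double_canal_deriv_def lc) simp
  have per: "double_canal (s + 4 * pi) = double_canal s" for s
  proof -
    have "cos (s + 4 * pi) = cos s" "sin (s + 4 * pi) = sin s"
      using cos_periodic[of "s + 2 * pi"] sin_periodic[of "s + 2 * pi"] by (simp_all add: add.assoc)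
    moreover have "cos ((s + 4 * pi) / 2) = cos (s / 2)"
      using cos_periodic[of "s / 2"] by (simp add: add_divide_distrib)
    ultimately show ?thesis by (simp only: double_canal_def)
  qed
  have k: "?k s = (2 + 3/4 * cos (s / 2)) *\<^sub>R ?v" for s
  proof -
    have "?k s = double_canal s + double_canal_deriv 2 s"
      using geodesic_curvature_vector_eq[OF sm ds, of s] al d2
      by (simp add: arc_length_parametrized_def)
    also have "\<dots> = (2 + 3/4 * cos (s / 2)) *\<^sub>R ?v"
      by (simp add: double_canal_def double_canal_deriv_def vec_eq_iff power2_eq_square algebra_simps)
    finally show ?thesis .
  qed
  have pos: "2 + 3/4 * cos (s / 2) > 0" for s :: real
    using cos_ge_minus_one[of "s / 2"] by linarith
  have v0: "?v \<noteq> 0"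
    by (auto simp: vec_eq_iff axis_def intro!: exI[of _ 3])
  have lv: "lorentz (c *\<^sub>R ?v) (c *\<^sub>R ?v) = 0" for c
    using lc[of 0 0 c] by simp
  show "closed_almost_regular_canal double_canal (4 * pi)"
    unfolding closed_almost_regular_canal_def closed_space_like_curve_def
      arc_length_parametrized_def space_like_def k
    using sm per ds al lv v0 pos by (auto simp: less_imp_neq[symmetric])
  show "curvature_line_light_like_constant double_canal"
    unfolding curvature_line_light_like_constant_def
  proof (intro exI[of _ "span {?v}"] conjI allI ballI)
    show "span {?k s} = span {?v}" for s
      unfolding k using pos[of s] span_image_scale[of "{?v}" "\<lambda>_. 2 + 3/4 * cos (s / 2)"] by simp
    show "light_like v" if "v \<in> span {?v}" for v
      using that lv by (auto simp: span_singleton light_like_def)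
  qed
  show "closed_length double_canal (4 * pi) = 4 * pi"
    by (simp add: closed_length_def al)
  show "4 * pi \<le> T" if T: "0 < T" "double_canal T = double_canal 0" for T
  proof -
    have "double_canal T $ 3 = double_canal 0 $ 3" using T by simp
    then have "cos (T / 2) = 1" by (simp add: double_canal_def axis_def)
    then obtain n :: int where "T / 2 = n * 2 * pi" by (auto simp: cos_one_2pi_int)
    then have n: "T = 4 * pi * n" by simp
    with T(1) have "n \<ge> 1" by (simp add: zero_less_mult_iff)
    with n show ?thesis by simp
  qed
qed

end

theory Submission
  imports Defs
begin

text \<open>Write \<open>k = \<sigma> + \<sigma>''\<close>. It is causal and never zero, so its last coordinate has constant sign and
  \<open>\<langle>k(s), k(t)\<rangle> \<le> 0\<close> for all \<open>s\<close>, \<open>t\<close>. Put \<open>x = t - T/2\<close> and \<open>w(t) = (x sin x) / 2\<close>, so that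
  \<open>w'' + w = cos x\<close>. Integrating by parts twice in \<open>t\<close>, then twice in \<open>s\<close> (no boundary terms, by
  periodicity), then again in \<open>t\<close>, gives
  \<open>\<integral>\<integral> w(t) \<langle>k(s), k(s+t)\<rangle> dt ds = \<integral>\<integral> cos x \<langle>k(s), \<sigma>(s+t)\<rangle> dt ds
    = \<integral>\<integral> cos x \<langle>\<sigma>(s), k(s+t)\<rangle> dt ds = 2 T sin (T/2)\<close>.
  If \<open>T \<le> 2\<pi>\<close> then \<open>w \<ge> 0\<close> on \<open>[0, T]\<close> and the left-hand side is at most \<open>0\<close>, which excludes
  \<open>T < 2\<pi>\<close> and, for \<open>T = 2\<pi>\<close>, makes all the \<open>k(s)\<close> mutually orthogonal, hence light-like and parallel.
  Conversely, if \<open>k\<close> is always a multiple of \<open>v\<close>, then \<open>\<sigma>\<close> modulo \<open>v\<close> solves \<open>z'' + z = 0\<close>, so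
  \<open>\<sigma>(s + 2\<pi>) - \<sigma>(s)\<close> is a multiple of \<open>v\<close>; it vanishes for some \<open>s\<close> by the intermediate value theorem,
  which contradicts simplicity when \<open>T > 2\<pi>\<close>.\<close>

section \<open>Causal vectors of the Lorentz form\<close>

lemma UNIV_5: "(UNIV :: 5 set) = {1, 2, 3, 4, 5}"
proof -
  have "card {1, 2, 3, 4, 5 :: 5} = 5" by simp
  then show ?thesis
    by (intro card_subset_eq[symmetric]) simp_all
qed

lemma lorentz_commute: "lorentz x y = lorentz y x"
  by (simp add: lorentz_def mult.commute)

lemma lorentz_add_left: "lorentz (x + y) z = lorentz x z + lorentz y z"
  by (simp add: lorentz_def algebra_simps)

lemma lorentz_add_right: "lorentz x (y + z) = lorentz x y + lorentz x z"
  by (simp add: lorentz_def algebra_simps)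

lemma lorentz_scaleR: "lorentz (c *\<^sub>R x) (c *\<^sub>R x) = c\<^sup>2 * lorentz x x"
  by (simp add: lorentz_def power2_eq_square algebra_simps)

lemma continuous_on_lorentz [continuous_intros]:
  assumes "continuous_on S f" "continuous_on S g"
  shows "continuous_on S (\<lambda>x. lorentz (f x) (g x))"
  unfolding lorentz_def by (intro continuous_intros assms)

text \<open>On the hyperplane of vectors with last coordinate \<open>0\<close> the form is positive
  definite.\<close>

lemma causal_last_coordinate_nonzero:
  assumes "lorentz x x \<le> 0" "x \<noteq> 0"
  shows "x $ 5 \<noteq> 0"
proof
  assume 0: "x $ 5 = 0"
  then have "(x$1)\<^sup>2 + (x$2)\<^sup>2 + (x$3)\<^sup>2 + (x$4)\<^sup>2 \<le> 0"
    using assms(1) by (simp add: lorentz_def power2_eq_square)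
  then have "x$1 = 0 \<and> x$2 = 0 \<and> x$3 = 0 \<and> x$4 = 0"
    by (smt (verit) zero_le_power2 zero_eq_power2)
  with 0 have "\<forall>i\<in>UNIV. x $ i = 0" unfolding UNIV_5 by simp
  then show False using assms(2) by (simp add: vec_eq_iff)
qed

text \<open>The vector \<open>x\<^sub>5 y - y\<^sub>5 x\<close> has last coordinate \<open>0\<close>, so the form is nonnegative on it.\<close>

lemma causal_pair_identity:
  "2 * (x$5 * y$5) * lorentz x y + (\<Sum>i\<in>UNIV. (x$5 * y$i - y$5 * x$i)\<^sup>2)
     = (x$5)\<^sup>2 * lorentz y y + (y$5)\<^sup>2 * lorentz x x"
  unfolding UNIV_5 by (simp add: lorentz_def power2_eq_square algebra_simps)

text \<open>A reversed Cauchy-Schwarz argument: in \<open>causal_pair_identity\<close> the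
  right-hand side is nonpositive and the sum of squares nonnegative, so the remaining term is
  nonpositive.\<close>

lemma causal_pair_nonpos:
  assumes "lorentz x x \<le> 0" "lorentz y y \<le> 0" "0 < x$5 * y$5"
  shows "lorentz x y \<le> 0"
proof -
  have "(x$5)\<^sup>2 * lorentz y y \<le> 0" "(y$5)\<^sup>2 * lorentz x x \<le> 0"
    using assms by (auto simp: mult_le_0_iff)
  moreover have "0 \<le> (\<Sum>i\<in>UNIV. (x$5 * y$i - y$5 * x$i)\<^sup>2)"
    by (intro sum_nonneg) simp
  ultimately have "(2 * (x$5 * y$5)) * lorentz x y \<le> 0"
    using causal_pair_identity[of x y] by linarith
  then show ?thesis
    using assms(3) by (smt (verit) mult_pos_pos)
qed

text \<open>The equality case of the same identity: a sum of squares equals a sum of two nonpositive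
  terms, so all of them vanish and \<open>x\<close>, \<open>y\<close> are proportional.\<close>

lemma causal_pair_orthogonal:
  assumes "lorentz x x \<le> 0" "lorentz y y \<le> 0" "0 < x$5 * y$5" "lorentz x y = 0"
  shows "lorentz x x = 0" "span {x} = span {y}"
proof -
  have 1: "(x$5)\<^sup>2 * lorentz y y \<le> 0" "(y$5)\<^sup>2 * lorentz x x \<le> 0"
    using assms by (auto simp: mult_le_0_iff)
  have 2: "0 \<le> (\<Sum>i\<in>UNIV. (x$5 * y$i - y$5 * x$i)\<^sup>2)"
    by (intro sum_nonneg) simp
  have nz: "x$5 \<noteq> 0" "y$5 \<noteq> 0" using assms(3) by auto
  have "(y$5)\<^sup>2 * lorentz x x = 0" and s0: "(\<Sum>i\<in>UNIV. (x$5 * y$i - y$5 * x$i)\<^sup>2) = 0"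
    using 1 2 causal_pair_identity[of x y] unfolding assms(4) by linarith+
  then show "lorentz x x = 0" using nz by simp
  have "\<forall>i. x$5 * y$i = y$5 * x$i"
    using s0 by (subst (asm) sum_nonneg_eq_0_iff) auto
  then have "y = (y$5 / x$5) *\<^sub>R x"
    using nz by (simp add: vec_eq_iff field_simps)
  then show "span {x} = span {y}"
    using nz span_image_scale[of "{x}" "\<lambda>_. y$5 / x$5"] by simp
qed

section \<open>The oscillator equation on the line\<close>

text \<open>Green's identity for the operator \<open>f'' + f\<close>: the integrand is the
  derivative of the Wronskian \<open>g * f1 - g1 * f\<close>.\<close>

lemma oscillator_integral_by_parts:
  fixes f g :: "real \<Rightarrow> real"
  assumes "a \<le> b"
    and "\<And>t. (f has_real_derivative f1 t) (at t)" "\<And>t. (f1 has_real_derivative f2 t) (at t)"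
    and "\<And>t. (g has_real_derivative g1 t) (at t)" "\<And>t. (g1 has_real_derivative g2 t) (at t)"
  shows "((\<lambda>t. g t * (f2 t + f t) - (g2 t + g t) * f t) has_integral
     (g b * f1 b - g1 b * f b) - (g a * f1 a - g1 a * f a)) {a..b}"
proof (rule fundamental_theorem_of_calculus[OF assms(1)])
  fix t
  have "((\<lambda>t. g t * f1 t - g1 t * f t) has_real_derivative
      g t * (f2 t + f t) - (g2 t + g t) * f t) (at t)"
    by (rule derivative_eq_intros assms refl | simp add: algebra_simps)+
  then show "((\<lambda>t. g t * f1 t - g1 t * f t) has_vector_derivative
      g t * (f2 t + f t) - (g2 t + g t) * f t) (at t within {a..b})"
    by (simp add: has_real_derivative_iff_has_vector_derivative has_vector_derivative_at_within)
qed

lemma oscillator_2pi_periodic: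
  fixes z :: "real \<Rightarrow> real"
  assumes "\<And>t. (z has_real_derivative z1 t) (at t)" "\<And>t. (z1 has_real_derivative - z t) (at t)"
  shows "z (t + 2 * pi) = z t"
proof -
  \<comment> \<open>A first integral of the oscillator, chosen so that it equals \<open>z u\<close>
    both at \<open>u = t\<close> and at \<open>u = t + 2 * pi\<close>.\<close>
  have "((\<lambda>u. z u * cos (u - t) - z1 u * sin (u - t)) has_real_derivative 0) (at u)" for u
    by (rule derivative_eq_intros assms refl | simp add: algebra_simps)+
  then have "(\<lambda>u. z u * cos (u - t) - z1 u * sin (u - t)) (t + 2 * pi)
      = (\<lambda>u. z u * cos (u - t) - z1 u * sin (u - t)) t"
    by (intro DERIV_isconst_all allI)
  then show ?thesis by simp
qed

text \<open>The segment from \<open>x\<close> to \<open>y\<close> is cut into \<open>n\<close> equal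
  steps shorter than \<open>r\<close>. This spreads parallelism of the \<open>k s\<close> from small
  shifts to the whole line.\<close>

lemma locally_shift_invariant_const:
  fixes S :: "real \<Rightarrow> 'a"
  assumes "0 < r" "\<And>s t. 0 < t \<Longrightarrow> t < r \<Longrightarrow> S (s + t) = S s"
  shows "S x = S y"
proof -
  have le: "S x = S y" if "x < y" for x y
  proof -
    obtain n :: nat where n: "(y - x) / r < n" using reals_Archimedean2 by blast
    have "0 < (y - x) / r" using that assms(1) by simp
    then have n0: "0 < n" using n by (metis of_nat_0_less_iff order_less_trans)
    define d where "d = (y - x) / n"
    have d: "0 < d" "d < r"
      using that n n0 assms(1) by (auto simp: d_def field_simps)
    have "S (x + m * d) = S x" for m :: nat
    proof (induction m)
      case (Suc m)
      have "S ((x + m * d) + d) = S (x + m * d)" using assms(2) d by blast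
      with Suc show ?case by (simp add: algebra_simps)
    qed simp
    from this[of n] show ?thesis using n0 by (simp add: d_def)
  qed
  then show ?thesis by (metis linorder_less_linear)
qed

section \<open>Curvature vector of a closed canal: continuity, common cone, orthogonality\<close>

locale canal =
  fixes \<sigma> :: "real \<Rightarrow> real^5" and T :: real
  assumes canal: "closed_almost_regular_canal \<sigma> T"
begin

abbreviation "\<sigma>1 \<equiv> vderiv \<sigma>"
abbreviation "\<sigma>2 \<equiv> vderiv (vderiv \<sigma>)"
abbreviation "k \<equiv> geodesic_curvature_vector \<sigma>"

lemma T_pos: "0 < T"
  and smooth: "smooth_curve \<sigma>"
  and periodic: "\<sigma> (s + T) = \<sigma> s"
  and norm_curve: "lorentz (\<sigma> s) (\<sigma> s) = 1"
  and norm_deriv: "lorentz (\<sigma>1 s) (\<sigma>1 s) = 1"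
  and k_causal: "lorentz (k s) (k s) \<le> 0"
  and k_nonzero: "k s \<noteq> 0"
  using canal by (auto simp: closed_almost_regular_canal_def closed_space_like_curve_def
      arc_length_parametrized_def de_sitter_def)

lemma k_eq: "k s = \<sigma> s + \<sigma>2 s"
  by (rule geodesic_curvature_vector_eq)
    (auto simp: smooth norm_curve norm_deriv de_sitter_def arc_length_parametrized_def)

lemmas deriv1 = smooth_curve_vderiv(1)[OF smooth]
lemmas deriv2 = smooth_curve_vderiv(2)[OF smooth]

lemma continuous_on_\<sigma> [continuous_intros]:
  assumes "continuous_on A f"
  shows "continuous_on A (\<lambda>x. \<sigma> (f x))"
proof -
  have "continuous_on UNIV \<sigma>"
    by (intro continuous_at_imp_continuous_on ballI has_vector_derivative_continuous[OF deriv1])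
  then show ?thesis using assms by (rule continuous_on_compose2) simp
qed

lemma continuous_on_k [continuous_intros]:
  assumes "continuous_on A f"
  shows "continuous_on A (\<lambda>x. k (f x))"
proof -
  have "\<sigma>2 differentiable (at t)" for t
    using smooth[unfolded smooth_curve_def, rule_format, of 2 t] by (simp add: numeral_2_eq_2)
  then have "continuous_on UNIV \<sigma>2"
    by (simp add: continuous_at_imp_continuous_on differentiable_imp_continuous_within)
  then have "continuous_on UNIV (\<lambda>s. \<sigma> s + \<sigma>2 s)"
    by (intro continuous_intros)
  then have "continuous_on UNIV k" by (simp add: k_eq[abs_def])
  then show ?thesis using assms by (rule continuous_on_compose2) simp
qed

lemma lorentz_k_right: "lorentz x (k s) = lorentz x (\<sigma>2 s) + lorentz x (\<sigma> s)"
  by (simp add: k_eq lorentz_add_right)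

text \<open>The last coordinate of \<open>k\<close> is continuous on a connected line and never
  \<open>0\<close>, so it cannot change sign.\<close>

lemma k_same_cone: "0 < k s $ 5 * k t $ 5"
proof (rule ccontr)
  assume "\<not> ?thesis"
  then have "(k s $ 5 \<le> 0 \<and> 0 \<le> k t $ 5) \<or> (k t $ 5 \<le> 0 \<and> 0 \<le> k s $ 5)"
    unfolding zero_less_mult_iff by linarith
  moreover have c: "connected (range (\<lambda>s. k s $ 5))"
    by (rule connected_continuous_image[OF _ connected_UNIV]) (intro continuous_intros)
  ultimately have "0 \<in> range (\<lambda>s. k s $ 5)"
    using connectedD_interval[OF c rangeI[of _ s] rangeI[of _ t], of 0]
      connectedD_interval[OF c rangeI[of _ t] rangeI[of _ s], of 0] by blast
  then obtain u where "k u $ 5 = 0" by (auto simp: image_iff)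
  then show False
    using causal_last_coordinate_nonzero[OF k_causal k_nonzero] by blast
qed

lemma k_pair_nonpos: "lorentz (k s) (k t) \<le> 0"
  by (rule causal_pair_nonpos[OF k_causal k_causal k_same_cone])

lemma periodic_deriv: "\<sigma>1 (s + T) = \<sigma>1 s"
proof -
  have "((\<lambda>s. \<sigma> (s + T)) has_vector_derivative 1 *\<^sub>R \<sigma>1 (s + T)) (at s)"
    by (rule vector_diff_chain_at[OF _ deriv1, unfolded o_def]) (auto intro!: derivative_eq_intros)
  then have "(\<sigma> has_vector_derivative \<sigma>1 (s + T)) (at s)"
    by (simp add: periodic)
  then show ?thesis
    using deriv1 vector_derivative_unique_at by blast
qed

lemma deriv_orthogonal: "lorentz (\<sigma>1 s) (\<sigma> s) = 0"
proof -
  have "((\<lambda>t. lorentz (\<sigma> t) (\<sigma> t)) has_real_derivative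
      lorentz (\<sigma>1 s) (\<sigma> s) + lorentz (\<sigma> s) (\<sigma>1 s)) (at s)"
    by (intro lorentz_has_derivative deriv1)
  then have "((\<lambda>t. 1) has_real_derivative 2 * lorentz (\<sigma>1 s) (\<sigma> s)) (at s)"
    by (simp add: norm_curve lorentz_commute)
  then have "2 * lorentz (\<sigma>1 s) (\<sigma> s) = 0"
    by (rule DERIV_unique[OF _ DERIV_const])
  then show ?thesis by simp
qed

text \<open>Together with \<open>k_orthogonal_deriv\<close>, this kills the boundary terms in
  \<open>k_k_integral\<close>.\<close>

lemma k_orthogonal: "lorentz (k s) (\<sigma> s) = 0"
proof -
  have "((\<lambda>t. lorentz (\<sigma>1 t) (\<sigma> t)) has_real_derivative
      lorentz (\<sigma>2 s) (\<sigma> s) + lorentz (\<sigma>1 s) (\<sigma>1 s)) (at s)"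
    by (intro lorentz_has_derivative deriv1 deriv2)
  then have "((\<lambda>t. 0) has_real_derivative lorentz (\<sigma>2 s) (\<sigma> s) + 1) (at s)"
    by (simp add: deriv_orthogonal norm_deriv)
  then have "lorentz (\<sigma>2 s) (\<sigma> s) + 1 = 0"
    by (rule DERIV_unique[OF _ DERIV_const])
  then show ?thesis by (simp add: k_eq lorentz_add_left norm_curve)
qed

lemma k_orthogonal_deriv: "lorentz (k s) (\<sigma>1 s) = 0"
proof -
  have "((\<lambda>t. lorentz (\<sigma>1 t) (\<sigma>1 t)) has_real_derivative
      lorentz (\<sigma>2 s) (\<sigma>1 s) + lorentz (\<sigma>1 s) (\<sigma>2 s)) (at s)"
    by (intro lorentz_has_derivative deriv2)
  then have "((\<lambda>t. 1) has_real_derivative 2 * lorentz (\<sigma>2 s) (\<sigma>1 s)) (at s)"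
    by (simp add: norm_deriv lorentz_commute)
  then have "2 * lorentz (\<sigma>2 s) (\<sigma>1 s) = 0"
    by (rule DERIV_unique[OF _ DERIV_const])
  then show ?thesis
    by (subst lorentz_commute)
      (simp add: lorentz_k_right lorentz_commute[of "\<sigma>1 s" "\<sigma>2 s"] deriv_orthogonal)
qed

lemma shifted_deriv:
  "((\<lambda>t. \<sigma> (s + t)) has_vector_derivative \<sigma>1 (s + t)) (at t)"
  "((\<lambda>t. \<sigma>1 (s + t)) has_vector_derivative \<sigma>2 (s + t)) (at t)"
proof -
  have s: "((\<lambda>t. s + t) has_vector_derivative 1) (at t)"
    by (auto intro!: derivative_eq_intros)
  show "((\<lambda>t. \<sigma> (s + t)) has_vector_derivative \<sigma>1 (s + t)) (at t)"
    using vector_diff_chain_at[OF s deriv1] by (simp add: o_def)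
  show "((\<lambda>t. \<sigma>1 (s + t)) has_vector_derivative \<sigma>2 (s + t)) (at t)"
    using vector_diff_chain_at[OF s deriv2] by (simp add: o_def)
qed

lemma lorentz_shifted_deriv:
  "((\<lambda>t. lorentz x (\<sigma> (s + t))) has_real_derivative lorentz x (\<sigma>1 (s + t))) (at t)"
  "((\<lambda>t. lorentz x (\<sigma>1 (s + t))) has_real_derivative lorentz x (\<sigma>2 (s + t))) (at t)"
proof -
  have c: "((\<lambda>_. x) has_vector_derivative 0) (at t)" by simp
  show "((\<lambda>t. lorentz x (\<sigma> (s + t))) has_real_derivative lorentz x (\<sigma>1 (s + t))) (at t)"
    "((\<lambda>t. lorentz x (\<sigma>1 (s + t))) has_real_derivative lorentz x (\<sigma>2 (s + t))) (at t)"
    using lorentz_has_derivative[OF c shifted_deriv(1)] lorentz_has_derivative[OF c shifted_deriv(2)]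
    by (simp_all add: lorentz_def)
qed

section \<open>The weight function and the double integral\<close>

definition weight :: "real \<Rightarrow> real" where
  "weight t = (t - T / 2) * sin (t - T / 2) / 2"

lemma continuous_on_weight [continuous_intros]:
  fixes f :: "'a::t2_space \<Rightarrow> real"
  assumes "continuous_on A f"
  shows "continuous_on A (\<lambda>x. weight (f x))"
  unfolding weight_def by (intro continuous_intros assms) simp

text \<open>With \<open>x = t - T / 2\<close> the bound on \<open>T\<close> gives |x| \<le>
  \<open>pi\<close>, where \<open>x\<close> and \<open>sin x\<close> never have opposite
  signs.\<close>

lemma weight_nonneg:
  assumes "T \<le> 2 * pi" "t \<in> {0..T}"
  shows "0 \<le> weight t"
proof (cases "T / 2 \<le> t")
  case True
  then have "0 \<le> sin (t - T / 2)" using assms by (intro sin_ge_zero) auto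
  with True show ?thesis by (simp add: weight_def)
next
  case False
  then have "0 \<le> sin (T / 2 - t)" using assms by (intro sin_ge_zero) auto
  with False have "0 \<le> (T / 2 - t) * sin (T / 2 - t)" by simp
  also have "\<dots> = (t - T / 2) * sin (t - T / 2)"
    using sin_minus[of "t - T / 2"] by (simp add: algebra_simps)
  finally show ?thesis by (simp add: weight_def)
qed

lemma k_k_integral:
  "integral {0..T} (\<lambda>t. weight t * lorentz (k s) (k (s + t)))
     = integral {0..T} (\<lambda>t. cos (t - T / 2) * lorentz (k s) (\<sigma> (s + t)))"
proof -
  \<comment> \<open>First and second derivatives of \<open>weight\<close>; the second is written so
    that \<open>w2 t + weight t\<close> collapses to the cosine.\<close>
  define w1 w2 where "w1 t = (sin (t - T / 2) + (t - T / 2) * cos (t - T / 2)) / 2"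
    and "w2 t = cos (t - T / 2) - weight t" for t
  have w: "(weight has_real_derivative w1 t) (at t)" "(w1 has_real_derivative w2 t) (at t)" for t
    unfolding weight_def[abs_def] w1_def[abs_def] w2_def
    by (auto intro!: derivative_eq_intros simp: field_simps)
  have "((\<lambda>t. weight t * (lorentz (k s) (\<sigma>2 (s + t)) + lorentz (k s) (\<sigma> (s + t)))
      - (w2 t + weight t) * lorentz (k s) (\<sigma> (s + t))) has_integral 0) {0..T}"
    using oscillator_integral_by_parts[OF _ lorentz_shifted_deriv w, of 0 T "k s" s] T_pos
    by (simp add: periodic periodic_deriv k_orthogonal k_orthogonal_deriv)
  then have "((\<lambda>t. weight t * lorentz (k s) (k (s + t))
      - cos (t - T / 2) * lorentz (k s) (\<sigma> (s + t))) has_integral 0) {0..T}"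
    by (simp add: w2_def lorentz_k_right)
  moreover have "(\<lambda>t. weight t * lorentz (k s) (k (s + t))) integrable_on {0..T}"
    "(\<lambda>t. cos (t - T / 2) * lorentz (k s) (\<sigma> (s + t))) integrable_on {0..T}"
    by (intro integrable_continuous_interval continuous_intros)+
  ultimately show ?thesis
    by (simp add: has_integral_iff integral_diff)
qed

lemma \<sigma>_k_integral:
  "integral {0..T} (\<lambda>t. cos (t - T / 2) * lorentz (\<sigma> s) (k (s + t))) = 2 * sin (T / 2)"
proof -
  have c: "((\<lambda>t. cos (t - T / 2)) has_real_derivative - sin (t - T / 2)) (at t)"
    "((\<lambda>t. - sin (t - T / 2)) has_real_derivative - cos (t - T / 2)) (at t)" for t
    by (auto intro!: derivative_eq_intros)
  \<comment> \<open>The cosine solves the homogeneous equation, so only boundary terms remain: each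
    end contributes \<open>sin (T / 2)\<close>, because
    \<open>lorentz (\<sigma> s) (\<sigma> (s + t))\<close> is \<open>1\<close> with derivative
    \<open>0\<close> at both ends.\<close>
  have "((\<lambda>t. cos (t - T / 2) * (lorentz (\<sigma> s) (\<sigma>2 (s + t)) + lorentz (\<sigma> s) (\<sigma> (s + t))))
      has_integral 2 * sin (T / 2)) {0..T}"
    using oscillator_integral_by_parts[OF _ lorentz_shifted_deriv c, of 0 T "\<sigma> s" s] T_pos
    by (simp add: periodic periodic_deriv norm_curve lorentz_commute[of "\<sigma> s" "\<sigma>1 s"] deriv_orthogonal)
  then show ?thesis
    by (simp add: lorentz_k_right has_integral_iff)
qed

text \<open>The operator \<open>f'' + f\<close> is symmetric on periodic functions: the two
  integrands differ by the derivative of the periodic Wronskian \<open>B\<close>.\<close>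

lemma integral_period_exchange:
  "integral {a..a + T} (\<lambda>s. lorentz (k s) (\<sigma> (s + t)))
     = integral {a..a + T} (\<lambda>s. lorentz (\<sigma> s) (k (s + t)))"
proof -
  define B where "B s = lorentz (\<sigma>1 s) (\<sigma> (s + t)) - lorentz (\<sigma> s) (\<sigma>1 (s + t))" for s
  have sh: "((\<lambda>s. \<sigma> (s + t)) has_vector_derivative \<sigma>1 (s + t)) (at s)"
    "((\<lambda>s. \<sigma>1 (s + t)) has_vector_derivative \<sigma>2 (s + t)) (at s)" for s
    using shifted_deriv[of t s] by (simp_all add: add.commute)
  have "(B has_real_derivative lorentz (k s) (\<sigma> (s + t)) - lorentz (\<sigma> s) (k (s + t))) (at s)" for s
    using DERIV_diff[OF lorentz_has_derivative[OF deriv2 sh(1)] lorentz_has_derivative[OF deriv1 sh(2)]]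
    by (simp add: B_def[abs_def] k_eq lorentz_add_left lorentz_add_right algebra_simps)
  then have "((\<lambda>s. lorentz (k s) (\<sigma> (s + t)) - lorentz (\<sigma> s) (k (s + t)))
      has_integral B (a + T) - B a) {a..a + T}"
    using T_pos by (intro fundamental_theorem_of_calculus)
      (auto simp: has_real_derivative_iff_has_vector_derivative has_vector_derivative_at_within)
  moreover have "a + T + t = a + t + T" by simp
  then have "B (a + T) = B a"
    by (simp only: B_def periodic periodic_deriv)
  moreover have "(\<lambda>s. lorentz (k s) (\<sigma> (s + t))) integrable_on {a..a + T}"
    "(\<lambda>s. lorentz (\<sigma> s) (k (s + t))) integrable_on {a..a + T}"
    by (intro integrable_continuous_interval continuous_intros)+
  ultimately show ?thesis
    by (simp add: has_integral_iff integral_diff)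
qed

text \<open>The start \<open>a\<close> of the period is free so that
  \<open>k_pair_orthogonal\<close> can begin the window at any prescribed point.\<close>

lemma double_integral_identity:
  "integral {a..a + T} (\<lambda>s. integral {0..T} (\<lambda>t. weight t * lorentz (k s) (k (s + t))))
     = 2 * T * sin (T / 2)"
proof -
  have 1: "continuous_on A (\<lambda>(s, t). cos (t - T / 2) * lorentz (k s) (\<sigma> (s + t)))"
    and 2: "continuous_on A (\<lambda>(s, t). cos (t - T / 2) * lorentz (\<sigma> s) (k (s + t)))" for A
    unfolding split_def
    by (intro continuous_intros)+
  have "integral {a..a + T} (\<lambda>s. integral {0..T} (\<lambda>t. weight t * lorentz (k s) (k (s + t))))
      = integral {a..a + T} (\<lambda>s. integral {0..T} (\<lambda>t. cos (t - T / 2) * lorentz (k s) (\<sigma> (s + t))))"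
    by (simp only: k_k_integral)
  \<comment> \<open>With \<open>s\<close> as the inner variable and \<open>t\<close> fixed,
    \<open>integral_period_exchange\<close> applies.\<close>
  also have "\<dots> = integral {0..T} (\<lambda>t. integral {a..a + T} (\<lambda>s. cos (t - T / 2) * lorentz (k s) (\<sigma> (s + t))))"
    using integral_swap_continuous[OF 1] by simp
  also have "\<dots> = integral {0..T} (\<lambda>t. integral {a..a + T} (\<lambda>s. cos (t - T / 2) * lorentz (\<sigma> s) (k (s + t))))"
    by (simp add: integral_period_exchange)
  also have "\<dots> = integral {a..a + T} (\<lambda>s. integral {0..T} (\<lambda>t. cos (t - T / 2) * lorentz (\<sigma> s) (k (s + t))))"
    using integral_swap_continuous[OF 2] by simp
  also have "\<dots> = 2 * T * sin (T / 2)"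
    using T_pos by (simp add: \<sigma>_k_integral)
  finally show ?thesis .
qed

section \<open>The lower bound and its equality case\<close>

lemma weighted_pair_nonpos:
  assumes "T \<le> 2 * pi" "t \<in> {0..T}"
  shows "weight t * lorentz (k s) (k (s + t)) \<le> 0"
  using weight_nonneg[OF assms] k_pair_nonpos by (simp add: mult_nonneg_nonpos)

lemma continuous_weighted_pair:
  "continuous_on A (\<lambda>(s, t). weight t * lorentz (k s) (k (s + t)))"
  unfolding split_def by (intro continuous_intros)

lemma inner_nonpos:
  assumes "T \<le> 2 * pi"
  shows "integral {0..T} (\<lambda>t. weight t * lorentz (k s) (k (s + t))) \<le> 0"
proof -
  have "integral {0..T} (\<lambda>t. weight t * lorentz (k s) (k (s + t))) \<le> integral {0..T} (\<lambda>t. 0)"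
    using weighted_pair_nonpos[OF assms]
    by (intro integral_le integrable_continuous_interval continuous_intros)
  then show ?thesis by simp
qed

lemma continuous_inner_integral:
  "continuous_on {a..b} (\<lambda>s. integral {0..T} (\<lambda>t. weight t * lorentz (k s) (k (s + t))))"
  using integral_continuous_on_param[of "{a..b}" 0 T "\<lambda>s t. weight t * lorentz (k s) (k (s + t))"]
    continuous_weighted_pair by simp

lemma length_ge: "2 * pi \<le> T"
proof (rule ccontr)
  assume "\<not> ?thesis"
  then have T: "T < 2 * pi" by simp
  have "integral {0..0 + T} (\<lambda>s. integral {0..T} (\<lambda>t. weight t * lorentz (k s) (k (s + t))))
      \<le> integral {0..0 + T} (\<lambda>t. 0)"
    using T by (intro integral_le integrable_continuous_interval continuous_inner_integral
        inner_nonpos continuous_intros) auto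
  then have "2 * T * sin (T / 2) \<le> 0"
    unfolding double_integral_identity by simp
  \<comment> \<open>Here \<open>T / 2\<close> lies strictly between \<open>0\<close> and
    \<open>pi\<close>.\<close>
  moreover have "0 < sin (T / 2)"
    using T T_pos by (intro sin_gt_zero) auto
  ultimately show False
    using T_pos by (simp add: mult_le_0_iff)
qed

text \<open>The double integral is \<open>2 * T * sin pi = 0\<close>, while its continuous integrand
  has constant sign, so the integrand vanishes. Shifts stop short of \<open>pi\<close>, where
  \<open>weight\<close> itself vanishes.\<close>

lemma k_pair_orthogonal:
  assumes T: "T = 2 * pi" and t: "0 < t" "t < pi"
  shows "lorentz (k s) (k (s + t)) = 0"
proof -
  \<comment> \<open>The sign is flipped because \<open>integral_eq_0_iff\<close> is applied to
    nonnegative functions.\<close>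
  define A where "A s = - integral {0..T} (\<lambda>t. weight t * lorentz (k s) (k (s + t)))" for s
  have "integral {s..s + T} A = 0"
    unfolding A_def using double_integral_identity[of s] T by simp
  moreover have "continuous_on {s..s + T} A"
    unfolding A_def by (intro continuous_intros continuous_inner_integral)
  moreover have "0 \<le> A u" for u
    using inner_nonpos[of u] T by (simp add: A_def)
  ultimately have "\<forall>u\<in>{s..s + T}. A u = 0"
    using integral_eq_0_iff[of s "s + T" A] T_pos by auto
  then have "A s = 0" using T_pos by simp
  then have "integral {0..T} (\<lambda>t. - (weight t * lorentz (k s) (k (s + t)))) = 0"
    by (simp add: A_def)
  then have "\<forall>u\<in>{0..T}. - (weight u * lorentz (k s) (k (s + u))) = 0"
    using weighted_pair_nonpos[OF eq_refl[OF T]] T_pos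
    by (subst (asm) integral_eq_0_iff) (auto intro!: continuous_intros)
  then have "weight t * lorentz (k s) (k (s + t)) = 0"
    using t T by simp
  moreover have "0 < sin t" using t by (intro sin_gt_zero)
  then have "weight t \<noteq> 0" unfolding weight_def using t T by simp
  ultimately show ?thesis by simp
qed

lemma curvature_line_constant_if_length_2pi:
  assumes "T = 2 * pi"
  shows "curvature_line_light_like_constant \<sigma>"
proof -
  have par: "span {k (s + t)} = span {k s}" if "0 < t" "t < pi" for s t
    using causal_pair_orthogonal(2)[OF k_causal k_causal k_same_cone k_pair_orthogonal[OF assms that]]
    by metis
  have const: "span {k s} = span {k 0}" for s
    using locally_shift_invariant_const[of pi "\<lambda>s. span {k s}", OF pi_gt_zero par] .
  \<comment> \<open>The shift \<open>1\<close> serves as a sample point between \<open>0\<close> and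
    \<open>pi\<close>.\<close>
  have null: "lorentz (k 0) (k 0) = 0"
    using causal_pair_orthogonal(1)[OF k_causal k_causal k_same_cone k_pair_orthogonal[OF assms, of 1 0]]
      pi_gt3 by simp
  have "light_like v" if "v \<in> span {k 0}" for v
    using that null by (auto simp: span_singleton light_like_def lorentz_scaleR)
  then show ?thesis
    unfolding curvature_line_light_like_constant_def using const by blast
qed

section \<open>The converse for simple closed curves\<close>

lemma periodic_multiple: "\<sigma> (s + of_int n * T) = \<sigma> s"
proof (induction n rule: int_induct[of _ 0])
  case base
  show ?case by simp
next
  case (step1 i)
  have "s + of_int (i + 1) * T = (s + of_int i * T) + T" by (simp add: algebra_simps)
  with step1 show ?case by (simp only: periodic)
next
  case (step2 i)
  have "s + of_int i * T = (s + of_int (i - 1) * T) + T" by (simp add: algebra_simps)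
  with step2 show ?case by (simp only: periodic)
qed

lemma representative:
  obtains r n where "0 \<le> r" "r < T" "r = s + of_int n * T" "\<sigma> r = \<sigma> s"
proof
  let ?n = "- \<lfloor>s / T\<rfloor>"
  show "0 \<le> s + of_int ?n * T" "s + of_int ?n * T < T"
    using floor_divide_lower[OF T_pos, of s] floor_divide_upper[OF T_pos, of s]
    by (simp_all add: distrib_right)
qed (simp_all only: periodic_multiple)

text \<open>Reducing both parameters to \<open>{0..<T}\<close> would give the same representative,
  so \<open>d\<close> would be an integer multiple of \<open>T\<close> strictly between
  \<open>0\<close> and \<open>T\<close>.\<close>

lemma simple_closed_separates:
  assumes "simple_closed \<sigma> T" "0 < d" "d < T"
  shows "\<sigma> (s + d) \<noteq> \<sigma> s"
proof
  assume eq: "\<sigma> (s + d) = \<sigma> s"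
  obtain x m where x: "0 \<le> x" "x < T" "x = s + of_int m * T" "\<sigma> x = \<sigma> s"
    by (rule representative)
  obtain y n where y: "0 \<le> y" "y < T" "y = (s + d) + of_int n * T" "\<sigma> y = \<sigma> (s + d)"
    by (rule representative)
  have "\<sigma> x = \<sigma> y" using x(4) y(4) eq by simp
  then have "x = y"
    using assms(1) x(1,2) y(1,2) by (simp add: simple_closed_def inj_on_eq_iff)
  then have "d = of_int (m - n) * T"
    unfolding of_int_diff left_diff_distrib using x(3) y(3) by linarith
  then have "0 < of_int (m - n) * T" "of_int (m - n) * T < 1 * T"
    using assms(2,3) by linarith+
  then have "0 < real_of_int (m - n)" "real_of_int (m - n) < 1"
    using T_pos by (simp_all only: zero_less_mult_pos2 mult_less_cancel_right_pos)
  then have "0 < m - n" "m - n < 1" by linarith+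
  then show False by linarith
qed

lemma length_2pi_if_curvature_line_constant:
  assumes "simple_closed \<sigma> T" "curvature_line_light_like_constant \<sigma>"
  shows "T = 2 * pi"
proof (rule ccontr)
  assume "T \<noteq> 2 * pi"
  then have T: "2 * pi < T" using length_ge by simp
  define v where "v = k 0"
  have v5: "v $ 5 \<noteq> 0"
    unfolding v_def by (intro causal_last_coordinate_nonzero k_causal k_nonzero)
  \<comment> \<open>Proportionality of \<open>k s\<close> to \<open>v\<close> in cross-multiplied
    form, which involves no scalar factor depending on \<open>s\<close>.\<close>
  have par: "v $ 5 * k s $ i = v $ i * k s $ 5" for s i
  proof -
    have "k s \<in> span {v}"
      using assms(2) span_base[of "k s" "{k s}"]
      unfolding curvature_line_light_like_constant_def v_def by auto
    then show ?thesis by (auto simp: span_singleton)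
  qed
  have comp: "((\<lambda>t. h t $ i) has_real_derivative h' $ i) (at t)"
    if "(h has_vector_derivative h') (at t)" for h :: "real \<Rightarrow> real^5" and h' i t
    using bounded_linear.has_vector_derivative[OF bounded_linear_vec_nth that]
    by (simp add: has_real_derivative_iff_has_vector_derivative)
  have mult: "v $ 5 * (\<sigma> (s + 2 * pi) $ i - \<sigma> s $ i) = v $ i * (\<sigma> (s + 2 * pi) $ 5 - \<sigma> s $ 5)" for s i
  proof -
    \<comment> \<open>A coordinate of \<open>\<sigma>\<close> modulo \<open>v\<close>: the same
      combination of coordinates of \<open>k\<close> vanishes by \<open>par\<close>, hence
      \<open>z'' = - z\<close>.\<close>
    define z z1 where "z t = v $ 5 * \<sigma> t $ i - v $ i * \<sigma> t $ 5"
      and "z1 t = v $ 5 * \<sigma>1 t $ i - v $ i * \<sigma>1 t $ 5" for t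
    have "(z has_real_derivative z1 t) (at t)" for t
      unfolding z_def[abs_def] z1_def
      by (rule derivative_eq_intros comp deriv1 refl | simp)+
    moreover have "(z1 has_real_derivative v $ 5 * \<sigma>2 t $ i - v $ i * \<sigma>2 t $ 5) (at t)" for t
      unfolding z1_def[abs_def]
      by (rule derivative_eq_intros comp deriv2 refl | simp)+
    moreover have "v $ 5 * \<sigma>2 t $ i - v $ i * \<sigma>2 t $ 5 = - z t" for t
      using par[of t i] by (simp add: z_def k_eq algebra_simps)
    ultimately have "z (s + 2 * pi) = z s"
      by (intro oscillator_2pi_periodic) auto
    then show ?thesis by (simp add: z_def algebra_simps)
  qed
  define e where "e s = \<sigma> (s + 2 * pi) $ 5 - \<sigma> s $ 5" for s
  have "continuous_on {0..T} (\<lambda>s. \<sigma> s $ 5)"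
    by (intro continuous_intros)
  \<comment> \<open>A maximum of the last coordinate over one period is global; it makes
    \<open>e\<close> nonpositive at \<open>m\<close> and nonnegative at
    \<open>m - 2 * pi\<close>.\<close>
  then obtain m where m: "\<forall>s\<in>{0..T}. \<sigma> s $ 5 \<le> \<sigma> m $ 5"
    using continuous_attains_sup[of "{0..T}" "\<lambda>s. \<sigma> s $ 5"] T_pos by auto
  have max: "\<sigma> s $ 5 \<le> \<sigma> m $ 5" for s
    by (rule representative[of s]) (metis m atLeastAtMost_iff less_imp_le)
  have "continuous_on {m - 2 * pi..m} e"
    unfolding e_def
    by (intro continuous_intros)
  moreover have "e m \<le> 0" "0 \<le> e (m - 2 * pi)"
    using max by (simp_all add: e_def)
  ultimately obtain s where s: "e s = 0"
    using IVT2'[of e m 0 "m - 2 * pi"] by auto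
  \<comment> \<open>By \<open>mult\<close> and \<open>v $ 5 \<noteq> 0\<close>, agreement in the
    last coordinate forces agreement in all of them.\<close>
  then have "\<sigma> (s + 2 * pi) = \<sigma> s"
    using mult[of s] v5 by (simp add: e_def vec_eq_iff)
  then show False
    using simple_closed_separates[OF assms(1), of "2 * pi" s] T by simp
qed

lemma closed_length_eq: "closed_length \<sigma> T = T"
  using T_pos by (simp add: closed_length_def norm_deriv)

end

text \<open>The converse is stated for simple curves because of \<open>double_canal\<close>, whose
  curvature line is light-like and constant at length \<open>4 * pi\<close>.\<close>

theorem theorem7:
  fixes \<sigma> :: "real \<Rightarrow> real^5" and T :: real
  assumes "closed_almost_regular_canal \<sigma> T"
  shows "closed_length \<sigma> T \<ge> 2 * pi
    \<and> (closed_length \<sigma> T = 2 * pi \<longrightarrow> curvature_line_light_like_constant \<sigma>)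
    \<and> (simple_closed \<sigma> T \<longrightarrow>
         (closed_length \<sigma> T = 2 * pi \<longleftrightarrow> curvature_line_light_like_constant \<sigma>))"
proof -
  interpret canal \<sigma> T by unfold_locales (rule assms)
  show ?thesis
    unfolding closed_length_eq using length_ge curvature_line_constant_if_length_2pi
      length_2pi_if_curvature_line_constant by blast
qed

end
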